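(* Let $\langle \mathcal{C},\sqsubseteq\rangle \overset{\alpha}{\underset{\gamma}{\rightleftarrows}} \langle \mathcal{A},\preccurlyeq\rangle$ be a Galois connection, where $\langle\mathcal{A},\preccurlyeq\rangle$ is a lattice with meet $\sqcap$. Let $e,e'\in\mathrm{Expr}$ be expressions with $e\cong e'$, and let $f:\mathcal{D}\to\mathcal{D}$ be a function such that $\llbracket e'\rrbracket_\rho = f(\llbracket e\rrbracket_\rho)$ for all $\rho\in I$ (so that $f(\llbracket e\rrbracket_\rho)=\llbracket e\rrbracket_\rho$ for all $\rho \in I$). Let $\bar f:\mathcal{A}\to\mathcal{A}$ be a sound abstraction of $f$, and define $\tilde f:\mathcal{A}\to\mathcal{A}$ by $\tilde f(a)=a\sqcap\bar f(a)$. Then $\alpha(\llbracket e\rrbracket)$ is a fixpoint of $\tilde f$, i.e. $\tilde f(\alpha(\llbracket e\rrbracket))=\alpha(\llbracket e\rrbracket)$.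
   Context: Expressions and semantics: $\mathcal{D}$ is a set (the domain of values), $I \subseteq \mathcal{D}^n$ is the set of allowed variable assignments (execution environments), and $\mathrm{Expr}$ is a set of expressions with a concrete semantics $\llbracket\cdot\rrbracket_{\cdot} \in \mathrm{Expr}\to I\to\mathcal{D}$; $\llbracket e\rrbracket_\rho\in\mathcal{D}$ is the value of $e$ under $\rho\in I$. Put $\llbracket e\rrbracket = \{\llbracket e\rrbracket_\rho \mid \rho\in I\}\subseteq\mathcal{D}$. Congruence: $e_a\cong e_b$ iff $\llbracket e_a\rrbracket_\rho=\llbracket e_b\rrbracket_\rho$ for all $\rho\in I$. In the motivating situation $e$ occurs as a subterm of $e'$ (a cycle in an e-graph), and $f$ is the interpretation of $e'$ as a function of the value of $e$, with all other subterms absorbed into $f$. Abstraction: the concrete domain $\langle\mathcal{C},\sqsubseteq\rangle$ is a poset whose elements are subsets of $\mathcal{D}$ (typically the power set of $\mathcal{D}$ ordered by inclusion) and which contains the sets $\llbracket e\rrbracket$. A pair $\alpha\in\mathcal{C}\to\mathcal{A}$, $\gamma\in\mathcal{A}\to\mathcal{C}$ is a Galois connection iff for all $P\in\mathcal{C}$ and $\overline{P}\in\mathcal{A}$: $\alpha(P)\preccurlyeq\overline{P}\Leftrightarrow P\sqsubseteq\gamma(\overline{P})$. An element $\overline{P}\in\mathcal{A}$ is a sound abstraction of $P\in\mathcal{C}$ iff $P\sqsubseteq\gamma(\overline{P})$. A function $\bar f:\mathcal{A}\to\mathcal{A}$ is a sound abstraction of $f:\mathcal{D}\to\mathcal{D}$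 iff whenever $a\in\mathcal{A}$ is a sound abstraction of $P\in\mathcal{C}$, the image $\{f(x)\mid x\in P\}$ belongs to $\mathcal{C}$ and $\bar f(a)$ is a sound abstraction of it, i.e. $\{f(x)\mid x\in P\}\sqsubseteq\gamma(\bar f(a))$. *)

theory Defs
  imports "HOL-Algebra.Galois_Connection"
begin

(* Variable assignments, the elements of D^n, are extensional functions on the indices 0, ..., n - 1. *)
locale expression_semantics =
  fixes D :: "'d set"
    and n :: nat
    and I :: "(nat \<Rightarrow> 'd) set"
    and Expr :: "'e set"
    and sem :: "'e \<Rightarrow> (nat \<Rightarrow> 'd) \<Rightarrow> 'd"
  assumes environments: "I \<subseteq> {..<n} \<rightarrow>\<^sub>E D"
    and sem_closed: "sem \<in> Expr \<rightarrow> I \<rightarrow> D"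

definition value_set :: "(nat \<Rightarrow> 'd) set \<Rightarrow> ('e \<Rightarrow> (nat \<Rightarrow> 'd) \<Rightarrow> 'd) \<Rightarrow> 'e \<Rightarrow> 'd set" where
  "value_set I sem e = {sem e \<rho> | \<rho>. \<rho> \<in> I}"

definition congruent_expr ::
  "(nat \<Rightarrow> 'd) set \<Rightarrow> ('e \<Rightarrow> (nat \<Rightarrow> 'd) \<Rightarrow> 'd) \<Rightarrow> 'e \<Rightarrow> 'e \<Rightarrow> bool" where
  "congruent_expr I sem ea eb \<longleftrightarrow> (\<forall>\<rho>\<in>I. sem ea \<rho> = sem eb \<rho>)"

(* The order of C is an arbitrary partial order; it need not be set inclusion. *)
locale concrete_domain =
  expression_semantics D n I Expr sem + partial_order C
  for D :: "'d set"
    and n :: nat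
    and I :: "(nat \<Rightarrow> 'd) set"
    and Expr :: "'e set"
    and sem :: "'e \<Rightarrow> (nat \<Rightarrow> 'd) \<Rightarrow> 'd"
    and C :: "'d set gorder" (structure) +
  assumes carrier_subsets: "carrier C \<subseteq> Pow D"
    and value_set_closed: "e \<in> Expr \<Longrightarrow> value_set I sem e \<in> carrier C"

definition sound_abstraction :: "'c gorder \<Rightarrow> ('a \<Rightarrow> 'c) \<Rightarrow> 'a \<Rightarrow> 'c \<Rightarrow> bool" where
  "sound_abstraction C \<gamma> a P \<longleftrightarrow> P \<sqsubseteq>\<^bsub>C\<^esub> \<gamma> a"

definition sound_fun_abstraction ::
  "'d set gorder \<Rightarrow> 'a gorder \<Rightarrow> ('a \<Rightarrow> 'd set) \<Rightarrow> ('a \<Rightarrow> 'a) \<Rightarrow> ('d \<Rightarrow> 'd) \<Rightarrow> bool" where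
  "sound_fun_abstraction C A \<gamma> fbar f \<longleftrightarrow>
     (\<forall>a\<in>carrier A. \<forall>P\<in>carrier C. sound_abstraction C \<gamma> a P \<longrightarrow>
        f ` P \<in> carrier C \<and> sound_abstraction C \<gamma> (fbar a) (f ` P))"

definition meet_with :: "'a gorder \<Rightarrow> ('a \<Rightarrow> 'a) \<Rightarrow> 'a \<Rightarrow> 'a" where
  "meet_with A fbar a = a \<sqinter>\<^bsub>A\<^esub> fbar a"

end

theory Submission
  imports Defs
begin

text \<open>Let V be the set of values of \<open>e\<close>. Congruence makes \<open>f\<close> fix
  every element of V, so f(V) = V (\<open>image_value_set_eq\<close>). The unit of the Galois
  connection gives V \<sqsubseteq> \<gamma>(\<alpha>(V)), and soundness of \<open>fbar\<close> turns
  this into V = f(V) \<sqsubseteq> \<gamma>(fbar(\<alpha>(V))). By adjunction \<alpha>(V) lies below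
  fbar(\<alpha>(V)), so the meet of the two is \<alpha>(V) (\<open>meet_absorb_le\<close>). No
  monotonicity of \<open>fbar\<close> enters.\<close>

lemma image_value_set_eq:
  assumes "congruent_expr I sem e e'" and "\<forall>\<rho>\<in>I. sem e' \<rho> = f (sem e \<rho>)"
  shows "f ` value_set I sem e = value_set I sem e"
proof -
  have fix_sem: "f (sem e \<rho>) = sem e \<rho>" if "\<rho> \<in> I" for \<rho>
    using assms that by (simp add: congruent_expr_def)
  have "value_set I sem e = sem e ` I"
    by (auto simp: value_set_def)
  then show ?thesis
    by (simp add: image_image fix_sem)
qed

lemma (in lower_semilattice) meet_absorb_le:
  assumes "x \<sqsubseteq> y" and "x \<in> carrier L" and "y \<in> carrier L"
  shows "x \<sqinter> y = x"
  using assms by (intro le_antisym meet_left meet_le) auto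

theorem lemma3:
  fixes D :: "'d set"
    and n :: nat
    and I :: "(nat \<Rightarrow> 'd) set"
    and Expr :: "'e set"
    and sem :: "'e \<Rightarrow> (nat \<Rightarrow> 'd) \<Rightarrow> 'd"
    and C :: "'d set gorder"
    and A :: "'a gorder"
    and \<alpha> :: "'d set \<Rightarrow> 'a"
    and \<gamma> :: "'a \<Rightarrow> 'd set"
    and e e' :: 'e
    and f :: "'d \<Rightarrow> 'd"
    and fbar :: "'a \<Rightarrow> 'a"
  assumes "concrete_domain D n I Expr sem C"
    and "lattice A"
    and "galois_connection \<lparr>orderA = C, orderB = A, lower = \<alpha>, upper = \<gamma>\<rparr>"
    and "e \<in> Expr" and "e' \<in> Expr"
    and "congruent_expr I sem e e'"
    and "f \<in> D \<rightarrow> D"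
    and "\<forall>\<rho>\<in>I. sem e' \<rho> = f (sem e \<rho>)"
    and "fbar \<in> carrier A \<rightarrow> carrier A"
    and "sound_fun_abstraction C A \<gamma> fbar f"
  shows "meet_with A fbar (\<alpha> (value_set I sem e)) = \<alpha> (value_set I sem e)"
proof -
  let ?G = "\<lparr>orderA = C, orderB = A, lower = \<alpha>, upper = \<gamma>\<rparr>"
  let ?V = "value_set I sem e"
  interpret A: lattice A by fact
  interpret G: galois_connection ?G by fact
  have V: "?V \<in> carrier C"
    using assms(1,4) by (rule concrete_domain.value_set_closed)
  have \<alpha>V: "\<alpha> ?V \<in> carrier A"
    using G.lower_closed V by simp
  have fbar_closed: "fbar (\<alpha> ?V) \<in> carrier A"
    using assms(9) \<alpha>V by auto
  \<comment> \<open>The unit of the adjunction: this is what allows soundness of \<open>fbar\<close>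
    to be applied at the point \<alpha>(V).\<close>
  have "sound_abstraction C \<gamma> (\<alpha> ?V) ?V"
    using G.inflation V by (simp add: sound_abstraction_def)
  then have "sound_abstraction C \<gamma> (fbar (\<alpha> ?V)) (f ` ?V)"
    using assms(10) \<alpha>V V unfolding sound_fun_abstraction_def by blast
  \<comment> \<open>The order of \<open>C\<close> need not be inclusion, so the image is replaced by
    V through an equality of sets; an inclusion would not suffice.\<close>
  then have "?V \<sqsubseteq>\<^bsub>C\<^esub> \<gamma> (fbar (\<alpha> ?V))"
    by (simp add: image_value_set_eq[OF assms(6,8)] sound_abstraction_def)
  \<comment> \<open>Transposing along the adjunction moves the comparison from \<open>C\<close> to
    \<open>A\<close>: \<alpha>(V) is a post-fixpoint in the sense a \<sqsubseteq> fbar(a), which is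
    exactly when the meet with fbar(a) returns a.\<close>
  then have "\<alpha> ?V \<sqsubseteq>\<^bsub>A\<^esub> fbar (\<alpha> ?V)"
    using G.left V fbar_closed by simp
  then show ?thesis
    unfolding meet_with_def using \<alpha>V fbar_closed by (rule A.meet_absorb_le)
qed

end
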